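(* Let $N \geq 4$ be an integer and let $A \subseteq (\mathbb{Z}/N\mathbb{Z})\smallsetminus\{0\}$ with $|A| \in \{1,2,3\}$. Let $G = \mathrm{Cay}(\mathbb{Z}/N\mathbb{Z},E_A)$ be the directed Cayley graph constructed from $A$. If $G$ is triangle-free, then $\beta(G) \leq \dfrac{\gamma(G)}{2}$.
   Context: A finite directed graph $G=(V,E)$ consists of a finite vertex set $V$ and an edge set $E \subseteq V\times V$. A directed cycle of length $l$ is a sequence of $l \ge 1$ edges $(v_{i-1},v_i)$, $i=1,\dots,l$, with $v_0=v_l$. A directed graph is triangle-free if it has no directed cycles of length $1$, $2$ or $3$ (no loops, digons, or triangles). A directed graph is acyclic if it has no directed cycles. $\beta(G)$ is the minimum size of a subset $X \subseteq E$ such that $(V, E\smallsetminus X)$ is acyclic. $\gamma(G)$ is the number of unordered pairs of distinct nonadjacent vertices in the undirected graph obtained from $G$ by replacing each directed edge with an undirected edge. For $A \subseteq \mathbb{Z}/N\mathbb{Z}$, the directed Cayley graph $\mathrm{Cay}(\mathbb{Z}/N\mathbb{Z},E_A)$ has vertex set $\mathbb{Z}/N\mathbb{Z}$ and edge set $E_A=\{(x,x+a): x\in\mathbb{Z}/N\mathbb{Z},\ a\in A\}$. *)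

theory Defs
  imports Graph_Theory.Digraph_Component "HOL-Number_Theory.Residues"
begin

text \<open>A digraph with edge set contained in \<open>V \<times> V\<close> is a \<^typ>\<open>'a pair_pre_digraph\<close>;
  \<^const>\<open>with_proj\<close> embeds it into the library's general digraphs.
  A directed cycle is any closed walk with at least one edge; vertices may repeat, so this is
  weaker than the library's \<open>pre_digraph.cycle\<close>.\<close>

definition directed_cycle :: "'a pair_pre_digraph \<Rightarrow> ('a \<times> 'a) list \<Rightarrow> bool" where
  "directed_cycle G p \<longleftrightarrow> length p \<ge> 1 \<and> (\<exists>v. pre_digraph.awalk (with_proj G) v p v)"

definition triangle_free :: "'a pair_pre_digraph \<Rightarrow> bool" where
  "triangle_free G \<longleftrightarrow> \<not> (\<exists>p. directed_cycle G p \<and> length p \<in> {1, 2, 3})"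

definition acyclic_digraph :: "'a pair_pre_digraph \<Rightarrow> bool" where
  "acyclic_digraph G \<longleftrightarrow> \<not> (\<exists>p. directed_cycle G p)"

text \<open>The next two numbers are meant for finite digraphs. There the minimum defining \<open>beta\<close>
  exists, because deleting all edges leaves an acyclic digraph.\<close>

definition beta :: "'a pair_pre_digraph \<Rightarrow> nat" where
  "beta G = (LEAST k. \<exists>X \<subseteq> parcs G. card X = k \<and>
     acyclic_digraph \<lparr>pverts = pverts G, parcs = parcs G - X\<rparr>)"

definition gamma :: "'a pair_pre_digraph \<Rightarrow> nat" where
  "gamma G = card {{u, v} | u v. u \<in> pverts G \<and> v \<in> pverts G \<and> u \<noteq> v \<and>
     (u, v) \<notin> parcs (mk_symmetric (with_proj G))}"

definition cayley_digraph :: "('a, 'b) ring_scheme \<Rightarrow> 'a set \<Rightarrow> 'a pair_pre_digraph" where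
  "cayley_digraph R A = \<lparr>pverts = carrier R,
     parcs = {(x, x \<oplus>\<^bsub>R\<^esub> a) | x a. x \<in> carrier R \<and> a \<in> A}\<rparr>"

end

theory Submission
  imports Defs
begin

text \<open>Let \<open>d = card A\<close>. Counting pairs gives \<open>2 \<gamma> \<ge> N (N - 1 - 2 d)\<close>. For \<open>u\<close> coprime to \<open>N\<close>,
  order the vertices by the residue of \<open>u x\<close>; the arcs \<open>(x, x + a)\<close> that fail to increase it are
  those that wrap around, and there are \<open>u a mod N\<close> of them. Hence \<open>\<beta>\<close> is at most the sum of
  \<open>u a mod N\<close> over \<open>A\<close>. The multipliers \<open>1\<close> and \<open>-1\<close> give \<open>2 \<beta> \<le> d N\<close>, which suffices if
  \<open>N \<ge> 4 d + 1\<close>. In the finitely many remaining triangle-free cases with \<open>d \<le> 3\<close>,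
  some multiplier still gives a sum of at most \<open>N (N - 1 - 2 d) / 4\<close>.\<close>

section \<open>Bounding \<open>beta\<close> by a labelling of the vertices\<close>

lemma awalk_strict_mono:
  fixes f :: "'a \<Rightarrow> 'b::order"
  assumes "pre_digraph.awalk (with_proj G) v p w" "p \<noteq> []"
    and "\<And>x y. (x, y) \<in> parcs G \<Longrightarrow> f x < f y"
  shows "f v < f w"
proof -
  have "pre_digraph.cas (with_proj G) v p w" "set p \<subseteq> parcs G"
    using assms(1) by (auto simp: pre_digraph.awalk_def)
  then have "f v < f w" using assms(2)
  proof (induction p arbitrary: v)
    case Nil
    then show ?case by simp
  next
    case (Cons e p)
    then have e: "e = (v, snd e)" "f v < f (snd e)"
      and p: "pre_digraph.cas (with_proj G) (snd e) p w"
      using assms(3)[of "fst e" "snd e"] by (auto simp: pre_digraph.cas.simps)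
    show ?case
    proof (cases "p = []")
      case True
      then show ?thesis using e p by (simp add: pre_digraph.cas.simps)
    next
      case False
      then show ?thesis using Cons.IH[OF p] Cons.prems(2) e(2) by (auto intro: less_trans)
    qed
  qed
  then show ?thesis .
qed

text \<open>Once the arcs along which \<open>f\<close> fails to increase are deleted,
  \<open>f\<close> grows strictly along every nonempty walk, so no walk can close up.\<close>

lemma beta_le_card_nonincreasing:
  fixes f :: "'a \<Rightarrow> 'b::linorder"
  shows "beta G \<le> card {(x, y) \<in> parcs G. f y \<le> f x}"
proof -
  let ?X = "{(x, y) \<in> parcs G. f y \<le> f x}"
  let ?H = "\<lparr>pverts = pverts G, parcs = parcs G - ?X\<rparr>"
  have "\<not> directed_cycle ?H p" for p
  proof
    assume "directed_cycle ?H p"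
    then obtain v where "pre_digraph.awalk (with_proj ?H) v p v" "p \<noteq> []"
      unfolding directed_cycle_def by fastforce
    then have "f v < f v" by (rule awalk_strict_mono) auto
    then show False by simp
  qed
  then have "acyclic_digraph ?H" by (simp add: acyclic_digraph_def)
  then show ?thesis unfolding beta_def by (intro Least_le exI[of _ ?X]) auto
qed

section \<open>Bounds on \<open>beta\<close> and \<open>gamma\<close> for Cayley digraphs of
  Z/N\<close>

lemma carrier_residue_ring: "carrier (residue_ring N) = {0..<N}"
  by (auto simp: residue_ring_def)

lemma add_residue_ring: "x \<oplus>\<^bsub>residue_ring N\<^esub> y = (x + y) mod N"
  by (simp add: residue_ring_def)

lemma zero_residue_ring: "\<zero>\<^bsub>residue_ring N\<^esub> = 0"
  by (simp add: residue_ring_def)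

lemma parcs_cayley_residue_ring:
  "parcs (cayley_digraph (residue_ring N) A) = (\<lambda>(x, a). (x, (x + a) mod N)) ` ({0..<N} \<times> A)"
  by (auto simp: cayley_digraph_def carrier_residue_ring add_residue_ring)

lemma pverts_cayley_residue_ring: "pverts (cayley_digraph (residue_ring N) A) = {0..<N}"
  by (simp add: cayley_digraph_def carrier_residue_ring)

text \<open>Multiplication by the unit \<open>u\<close> is injective on residues and turns a step by
  \<open>a\<close> into a step by \<open>c = u * a mod N\<close>. Such a step fails to increase the
  label only when it passes \<open>N\<close>, that is, from one of the top \<open>c\<close>
  labels.\<close>

lemma card_wrapping_le:
  fixes N u a :: int
  assumes N: "N > 0" and u: "coprime u N" and a: "\<not> N dvd a"
  shows "card {x \<in> {0..<N}. u * ((x + a) mod N) mod N \<le> u * x mod N} \<le> nat (u * a mod N)"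
proof -
  let ?S = "{x \<in> {0..<N}. u * ((x + a) mod N) mod N \<le> u * x mod N}"
  define c where "c = u * a mod N"
  \<comment> \<open>If \<open>c\<close> were 0, every arc would keep its label and \<open>?S\<close>
    would be all of \<open>{0..<N}\<close>.\<close>
  have "\<not> N dvd u * a" using u a by (simp add: coprime_dvd_mult_right_iff coprime_commute)
  then have c: "0 < c" "c < N"
    using N pos_mod_sign[OF N, of "u * a"] pos_mod_bound[OF N, of "u * a"]
    unfolding c_def dvd_eq_mod_eq_0 by linarith+
  have inj: "inj_on (\<lambda>x. u * x mod N) ?S"
  proof (rule inj_onI)
    fix x y assume xy: "x \<in> ?S" "y \<in> ?S" "u * x mod N = u * y mod N"
    then have "[u * x = u * y] (mod N)" by (simp add: cong_def)
    then have "[x = y] (mod N)" using u by (simp add: cong_mult_lcancel)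
    then show "x = y" using xy by (simp add: cong_def)
  qed
  have sub: "(\<lambda>x. u * x mod N) ` ?S \<subseteq> {N - c..<N}"
  proof
    fix z assume "z \<in> (\<lambda>x. u * x mod N) ` ?S"
    then obtain x where x: "z = u * x mod N" "u * ((x + a) mod N) mod N \<le> z" by auto
    have "u * ((x + a) mod N) mod N = (z + c) mod N"
      unfolding x(1) c_def by (simp add: mod_simps distrib_left)
    moreover have "0 \<le> z" "z < N" using x(1) N by auto
    ultimately show "z \<in> {N - c..<N}"
      using x(2) c mod_pos_pos_trivial[of "z + c" N] by (cases "z + c < N") auto
  qed
  have "card ?S \<le> card {N - c..<N}" by (rule card_inj_on_le[OF inj sub]) simp
  then show ?thesis by (simp add: c_def)
qed

lemma beta_cayley_le_sum:
  fixes N u :: int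
  assumes N: "N > 0" and u: "coprime u N" and "finite A" and A: "\<And>a. a \<in> A \<Longrightarrow> \<not> N dvd a"
  shows "int (beta (cayley_digraph (residue_ring N) A)) \<le> (\<Sum>a\<in>A. u * a mod N)"
proof -
  let ?G = "cayley_digraph (residue_ring N) A"
  define S where "S a = {x \<in> {0..<N}. u * ((x + a) mod N) mod N \<le> u * x mod N}" for a
  have fin: "finite (S a)" for a unfolding S_def by (rule finite_subset[of _ "{0..<N}"]) auto
  \<comment> \<open>The bad arcs are grouped by their generator \<open>a\<close>, ready for a union
    bound.\<close>
  have "{(x, y) \<in> parcs ?G. u * y mod N \<le> u * x mod N}
      = (\<Union>a\<in>A. (\<lambda>x. (x, (x + a) mod N)) ` S a)"
    by (auto simp: parcs_cayley_residue_ring S_def)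
  then have "beta ?G \<le> card (\<Union>a\<in>A. (\<lambda>x. (x, (x + a) mod N)) ` S a)"
    using beta_le_card_nonincreasing[of ?G "\<lambda>x. u * x mod N"] by simp
  also have "\<dots> \<le> (\<Sum>a\<in>A. card ((\<lambda>x. (x, (x + a) mod N)) ` S a))"
    using \<open>finite A\<close> by (rule card_UN_le)
  also have "\<dots> \<le> (\<Sum>a\<in>A. card (S a))"
    by (intro sum_mono card_image_le fin)
  also have "\<dots> \<le> (\<Sum>a\<in>A. nat (u * a mod N))"
    using card_wrapping_le[OF N u A] by (intro sum_mono) (simp add: S_def)
  finally have "int (beta ?G) \<le> (\<Sum>a\<in>A. int (nat (u * a mod N)))"
    by (metis of_nat_le_iff of_nat_sum)
  then show ?thesis using N by simp
qed

text \<open>There are N (N - 1) / 2 pairs in all, and adjacent ones come from at most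
  \<open>N * card A\<close> arcs. Loops or opposite arcs only make this an overcount of the adjacent
  pairs.\<close>

lemma gamma_cayley_ge:
  fixes N :: int
  assumes N: "N > 0" and "finite A"
  shows "N * (N - 1 - 2 * int (card A)) \<le> 2 * int (gamma (cayley_digraph (residue_ring N) A))"
proof -
  let ?G = "cayley_digraph (residue_ring N) A"
  define P where "P = {e. e \<subseteq> {0..<N} \<and> card e = 2}"
  define E where "E = (\<lambda>(x, y). {x, y}) ` parcs ?G"
  have "finite (parcs ?G)" using \<open>finite A\<close> by (simp add: parcs_cayley_residue_ring)
  then have finE: "finite E" by (simp add: E_def)
  have "card E \<le> card (parcs ?G)"
    unfolding E_def using \<open>finite (parcs ?G)\<close> by (rule card_image_le)
  also have "card (parcs ?G) \<le> card ({0..<N} \<times> A)"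
    unfolding parcs_cayley_residue_ring using \<open>finite A\<close> by (intro card_image_le) simp
  finally have cardE: "card E \<le> nat N * card A" by (simp add: card_cartesian_product)
  have "P - E \<subseteq> {{u, v} | u v. u \<in> pverts ?G \<and> v \<in> pverts ?G \<and> u \<noteq> v \<and>
     (u, v) \<notin> parcs (mk_symmetric (with_proj ?G))}" (is "_ \<subseteq> ?C")
  proof
    fix e assume e: "e \<in> P - E"
    then obtain u v where uv: "e = {u, v}" "u \<noteq> v" by (auto simp: P_def card_2_iff)
    have "(u, v) \<notin> parcs ?G" "(v, u) \<notin> parcs ?G"
      using e uv by (force simp: E_def insert_commute)+
    then have "(u, v) \<notin> parcs (mk_symmetric (with_proj ?G))"
      by (auto simp: parcs_mk_symmetric)
    then show "e \<in> ?C" using e uv by (auto simp: P_def pverts_cayley_residue_ring)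
  qed
  moreover have "finite ?C"
    by (rule finite_subset[of _ "Pow {0..<N}"]) (auto simp: pverts_cayley_residue_ring)
  ultimately have "card (P - E) \<le> gamma ?G" unfolding gamma_def by (intro card_mono)
  moreover have "card P - card E \<le> card (P - E)" using finE by (rule diff_card_le_card_Diff)
  moreover have "card P = nat N choose 2" unfolding P_def by (subst n_subsets) auto
  ultimately have "nat N choose 2 \<le> gamma ?G + nat N * card A" using cardE by linarith
  moreover have "2 * (nat N choose 2) = nat N * (nat N - 1)"
    unfolding choose_two by (rule dvd_mult_div_cancel) auto
  ultimately have "nat N * (nat N - 1) \<le> 2 * (gamma ?G + nat N * card A)"
    by (metis mult_le_mono2)
  then have "int (nat N * (nat N - 1)) \<le> int (2 * (gamma ?G + nat N * card A))" by linarith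
  then show ?thesis using N by (simp add: of_nat_diff algebra_simps)
qed

lemma beta_cayley_le_half_gamma:
  fixes N u :: int
  assumes "N > 0" "coprime u N" "finite A" "\<And>a. a \<in> A \<Longrightarrow> \<not> N dvd a"
    and "4 * (\<Sum>a\<in>A. u * a mod N) \<le> N * (N - 1 - 2 * int (card A))"
  shows "2 * beta (cayley_digraph (residue_ring N) A) \<le> gamma (cayley_digraph (residue_ring N) A)"
  using beta_cayley_le_sum[OF assms(1-4)] gamma_cayley_ge[OF assms(1,3)] assms(5) by linarith

section \<open>Large \<open>N\<close>: the multipliers 1 and -1\<close>

lemma exists_multiplier_large:
  fixes N :: int
  assumes N: "N \<ge> 4 * int (card A) + 1" and A: "A \<subseteq> {0<..<N}"
  shows "\<exists>u. coprime u N \<and> 4 * (\<Sum>a\<in>A. u * a mod N) \<le> N * (N - 1 - 2 * int (card A))"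
proof -
  define s where "s = (\<Sum>a\<in>A. a)"
  have pos: "(\<Sum>a\<in>A. 1 * a mod N) = s"
    unfolding s_def using A by (intro sum.cong) auto
  have "(\<Sum>a\<in>A. (- 1) * a mod N) = (\<Sum>a\<in>A. N - a)"
    \<comment> \<open>The residue of \<open>- a\<close> is \<open>N - a\<close> because
      \<open>a\<close> is nonzero modulo \<open>N\<close>.\<close>
    using A by (intro sum.cong) (auto simp: zmod_zminus1_eq_if dvd_eq_mod_eq_0)
  then have neg: "(\<Sum>a\<in>A. (- 1) * a mod N) = int (card A) * N - s"
    by (simp add: s_def sum_subtractf)
  define t where "t = int (card A) * N"
  \<comment> \<open>The lower bound on \<open>N\<close> enters here, as
    \<open>N - 1 - 2 * card A\<close> \<ge> \<open>2 * card A\<close>.\<close>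
  have "N * (2 * int (card A)) \<le> N * (N - 1 - 2 * int (card A))"
    using N by (intro mult_left_mono) auto
  then have "2 * t \<le> N * (N - 1 - 2 * int (card A))"
    by (simp add: t_def mult_ac)
  \<comment> \<open>The two sums add up to \<open>t\<close>, so the smaller is at most t / 2.
    Writing \<open>k\<close> for the product keeps the goal linear.\<close>
  moreover have "4 * s \<le> k \<or> 4 * (t - s) \<le> k" if "2 * t \<le> k" for k
    using that by arith
  ultimately have "4 * s \<le> N * (N - 1 - 2 * int (card A)) \<or>
      4 * (t - s) \<le> N * (N - 1 - 2 * int (card A))"
    by blast
  then show ?thesis
  proof
    assume "4 * s \<le> N * (N - 1 - 2 * int (card A))"
    then show ?thesis by (intro exI[of _ 1]) (simp only: pos coprime_1_left simp_thms)
  next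
    assume "4 * (t - s) \<le> N * (N - 1 - 2 * int (card A))"
    then show ?thesis by (intro exI[of _ "- 1"]) (simp only: neg t_def, simp)
  qed
qed

section \<open>Small \<open>N\<close>: from triangle-freeness to a finite check\<close>

lemma triangle_free_cayleyD:
  fixes N :: int
  assumes tf: "triangle_free (cayley_digraph (residue_ring N) A)" and N: "N > 0"
    and A: "A \<subseteq> {0..<N}" and abc: "a \<in> A" "b \<in> A" "c \<in> A"
  shows "(a + b) mod N \<noteq> 0" and "(a + b + c) mod N \<noteq> 0"
proof -
  let ?G = "cayley_digraph (residue_ring N) A"
  have no_walk: "\<not> pre_digraph.awalk (with_proj ?G) v p v" if "length p \<in> {1, 2, 3}" for v p
    using tf that unfolding triangle_free_def directed_cycle_def
    by (metis One_nat_def insert_iff empty_iff le_numeral_extra(4) one_le_numeral)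
  have arc: "(x, (x + a) mod N) \<in> parcs ?G" if "x \<in> {0..<N}" "a \<in> A" for x a
    using that by (force simp: parcs_cayley_residue_ring)
  \<comment> \<open>The walk starts at 0 and visits the partial sums of \<open>a\<close>,
    \<open>b\<close>, \<open>c\<close>; it closes exactly when the sum vanishes modulo
    \<open>N\<close>. Generators may repeat.\<close>
  have a: "(0, a) \<in> parcs ?G" using arc[of 0 a] N A abc by auto
  have b: "(a, (a + b) mod N) \<in> parcs ?G" using arc[of a b] A abc by auto
  have c: "((a + b) mod N, (a + b + c) mod N) \<in> parcs ?G"
    using arc[of "(a + b) mod N" c] N abc by (simp add: mod_simps)
  show "(a + b) mod N \<noteq> 0"
  proof
    assume "(a + b) mod N = 0"
    then have "pre_digraph.awalk (with_proj ?G) 0 [(0, a), (a, (a + b) mod N)] 0"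
      using a b N
      by (simp add: pre_digraph.awalk_def pre_digraph.cas.simps pverts_cayley_residue_ring)
    then show False using no_walk by fastforce
  qed
  show "(a + b + c) mod N \<noteq> 0"
  proof
    assume "(a + b + c) mod N = 0"
    then have "pre_digraph.awalk (with_proj ?G) 0
        [(0, a), (a, (a + b) mod N), ((a + b) mod N, (a + b + c) mod N)] 0"
      using a b c N
      by (simp add: pre_digraph.awalk_def pre_digraph.cas.simps pverts_cayley_residue_ring)
    then show False using no_walk by fastforce
  qed
qed

definition no_short_zero_sum :: "int \<Rightarrow> int list \<Rightarrow> bool" where
  "no_short_zero_sum N xs \<longleftrightarrow>
     (\<forall>a\<in>set xs. \<forall>b\<in>set xs. (a + b) mod N \<noteq> 0 \<and> (\<forall>c\<in>set xs. (a + b + c) mod N \<noteq> 0))"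

text \<open>An executable form of the multiplier condition: for \<open>N\<close> \<ge> 2 every unit
  modulo \<open>N\<close> has a representative in \<open>[1..N - 1]\<close>.\<close>

definition has_multiplier :: "int \<Rightarrow> int list \<Rightarrow> bool" where
  "has_multiplier N xs \<longleftrightarrow> (\<exists>u\<in>set [1..N - 1]. gcd u N = 1 \<and>
     4 * sum_list (map (\<lambda>a. u * a mod N) xs) \<le> N * (N - 1 - 2 * int (length xs)))"

lemma has_multiplier_1:
  "\<forall>N\<in>set [4..4]. \<forall>a\<in>set [1..N - 1]. no_short_zero_sum N [a] \<longrightarrow> has_multiplier N [a]"
  by code_simp

lemma has_multiplier_2:
  "\<forall>N\<in>set [4..8]. \<forall>a\<in>set [1..N - 1]. no_short_zero_sum N [a] \<longrightarrow>
     (\<forall>b\<in>set [a + 1..N - 1]. no_short_zero_sum N [a, b] \<longrightarrow> has_multiplier N [a, b])"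
  by code_simp

text \<open>The range of \<open>N\<close> is what \<open>N\<close> \<ge> 4 * 3 + 1 leaves over. For
  \<open>N\<close> \<le> 7 the bound is at most 0 and no multiplier can meet it, so there the short
  zero sums must exclude every triple. Increasing order lists each set once, and testing prefixes
  allows early rejection.\<close>

lemma has_multiplier_3:
  "\<forall>N\<in>set [4..12]. \<forall>a\<in>set [1..N - 1]. no_short_zero_sum N [a] \<longrightarrow>
     (\<forall>b\<in>set [a + 1..N - 1]. no_short_zero_sum N [a, b] \<longrightarrow>
       (\<forall>c\<in>set [b + 1..N - 1]. no_short_zero_sum N [a, b, c] \<longrightarrow> has_multiplier N [a, b, c]))"
  by code_simp

lemma no_short_zero_sum_subset:
  "no_short_zero_sum N ys \<Longrightarrow> set xs \<subseteq> set ys \<Longrightarrow> no_short_zero_sum N xs"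
  unfolding no_short_zero_sum_def by (meson subsetD)

lemma has_multiplier_small:
  fixes N :: int
  assumes N: "4 \<le> N" "N \<le> 4 * int (length xs)" and len: "length xs \<in> {1, 2, 3}"
    and xs: "sorted_wrt (<) xs" "set xs \<subseteq> {0<..<N}" and free: "no_short_zero_sum N xs"
  shows "has_multiplier N xs"
proof -
  consider a where "xs = [a]" | a b where "xs = [a, b]" | a b c where "xs = [a, b, c]"
    using len by (auto simp: numeral_eq_Suc length_Suc_conv)
  then show ?thesis
  proof cases
    case 1
    show ?thesis unfolding 1
      \<comment> \<open>\<open>set_upto\<close> turns the enumerated lists into intervals, whose
        membership conditions are linear inequalities.\<close>
      using N xs free 1 by (intro has_multiplier_1[unfolded set_upto, rule_format]; simp)
  next
    case 2
    have "no_short_zero_sum N [a]" using free by (rule no_short_zero_sum_subset) (simp add: 2)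
    then show ?thesis unfolding 2
      using N xs free 2 by (intro has_multiplier_2[unfolded set_upto, rule_format]; simp)
  next
    case 3
    have "no_short_zero_sum N [a]" "no_short_zero_sum N [a, b]"
      using free by (auto intro: no_short_zero_sum_subset simp: 3)
    then show ?thesis unfolding 3
      using N xs free 3 by (intro has_multiplier_3[unfolded set_upto, rule_format]; simp)
  qed
qed

theorem theorem3p8:
  fixes N :: int and A :: "int set"
  defines "G \<equiv> cayley_digraph (residue_ring N) A"
  assumes "N \<ge> 4"
    and "A \<subseteq> carrier (residue_ring N) - {\<zero>\<^bsub>residue_ring N\<^esub>}"
    and "card A \<in> {1, 2, 3}"
    and "triangle_free G"
  shows "real (beta G) \<le> real (gamma G) / 2"
proof -
  have N: "N > 0" using assms(2) by simp
  have A: "A \<subseteq> {0<..<N}"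
    using assms(3) by (force simp: carrier_residue_ring zero_residue_ring)
  then have fin: "finite A" by (rule finite_subset) simp
  have "\<exists>u. coprime u N \<and> 4 * (\<Sum>a\<in>A. u * a mod N) \<le> N * (N - 1 - 2 * int (card A))"
  proof (cases "N \<ge> 4 * int (card A) + 1")
    case True
    then show ?thesis using A by (rule exists_multiplier_large)
  next
    case False
    \<comment> \<open>The sorted enumeration matches the increasing order of the finite check, and
      its distinctness turns the list sum back into the sum over \<open>A\<close>.\<close>
    define xs where "xs = sorted_list_of_set A"
    have xs: "set xs = A" "length xs = card A" "sorted_wrt (<) xs" "distinct xs"
      using fin by (auto simp: xs_def)
    have "A \<subseteq> {0..<N}" using A by force
    then have "no_short_zero_sum N xs"
      unfolding no_short_zero_sum_def xs(1)
      by (intro ballI conjI) (rule triangle_free_cayleyD[OF assms(5)[unfolded G_def] N]; assumption)+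
    then have "has_multiplier N xs"
      using assms(2,4) False A xs by (intro has_multiplier_small) auto
    then show ?thesis
      using xs unfolding has_multiplier_def
      by (auto simp: sum_list_distinct_conv_sum_set coprime_iff_gcd_eq_1)
  qed
  then obtain u where "coprime u N"
    "4 * (\<Sum>a\<in>A. u * a mod N) \<le> N * (N - 1 - 2 * int (card A))" by blast
  moreover have "\<not> N dvd a" if "a \<in> A" for a
    using A that zdvd_not_zless[of a N] by auto
  ultimately have "2 * beta G \<le> gamma G"
    unfolding G_def using N fin by (intro beta_cayley_le_half_gamma)
  then show ?thesis by linarith
qed

end
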